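(* Let $\widetilde M=(\mathbb{R}^2,dt^2+f(t)^2d\theta^2)$ be a non-compact model surface of revolution admitting a finite total curvature $c(\widetilde M)<2\pi$, and let $K(t):=-f''(t)/f(t)$. Then for every $\varepsilon>0$ there exists a non-compact model surface of revolution $\widetilde M_\varepsilon^-=(\mathbb{R}^2,dt^2+m_\varepsilon^-(t)^2d\theta^2)$, with radial curvature $G_\varepsilon^-(t):=-m_\varepsilon^{-\,\prime\prime}(t)/m_\varepsilon^-(t)$, admitting a finite total curvature, such that $K\ge G_\varepsilon^-$ on $[0,\infty)$, $\|G_\varepsilon^--K\|_2:=\sqrt{\int_0^\infty|G_\varepsilon^--K|^2dt}<\varepsilon$, $\liminf_{t\to\infty}G_\varepsilon^-(t)=-\infty$, and $|c(\widetilde M)-c(\widetilde M_\varepsilon^-)|<\varepsilon$.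
   Context: A non-compact model surface of revolution is $\mathbb{R}^2$ with the metric $dt^2+m(t)^2d\theta^2$, where $(t,\theta)$ are polar coordinates about the origin and $m:(0,\infty)\to(0,\infty)$ is smooth, extends to a smooth odd function around $0$, and satisfies $m'(0)=1$. Its Gauss (radial) curvature is $-m''(t)/m(t)$. The total curvature of such a surface with Gauss curvature $G$ is $c:=\int G_+\,dA+\int G_-\,dA$ with $G_\pm$ the positive/negative parts ($G_+=\max\{G,0\}$, $G_-=\min\{G,0\}$) and $dA$ the area element; it is finite if both integrals are finite. *)

theory Defs
  imports "HOL-Analysis.Analysis"
begin

definition smooth_on :: "real set \<Rightarrow> (real \<Rightarrow> real) \<Rightarrow> bool" where
  "smooth_on S f \<longleftrightarrow> (\<forall>n::nat. \<forall>x\<in>S. ((deriv ^^ n) f) differentiable (at x))"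

text \<open>Warping function of a non-compact model surface of revolution
  (R^2, dt^2 + m(t)^2 dtheta^2): m is smooth and positive on (0,inf), extends to a smooth
  odd function around 0, and m'(0) = 1.\<close>
definition model_fun :: "(real \<Rightarrow> real) \<Rightarrow> bool" where
  "model_fun m \<longleftrightarrow>
     smooth_on {0<..} m \<and> (\<forall>t>0. m t > 0) \<and>
     (\<exists>g \<delta>. \<delta> > 0 \<and> smooth_on {-\<delta><..<\<delta>} g \<and> (\<forall>x. g (-x) = - g x) \<and>
            (\<forall>t\<in>{0<..<\<delta>}. g t = m t) \<and> deriv g 0 = 1)"

definition radial_curv :: "(real \<Rightarrow> real) \<Rightarrow> real \<Rightarrow> real" where
  "radial_curv m t = - deriv (deriv m) t / m t"

text \<open>Integrals of G_+ and G_- with respect to dA = m(t) dt dtheta, using polar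
  coordinates (t,theta) in (0,inf) x [0,2 pi); the theta integral gives the factor 2 pi.\<close>
definition pos_total_curv :: "(real \<Rightarrow> real) \<Rightarrow> real" where
  "pos_total_curv m = 2 * pi * (\<integral>t\<in>{0<..}. max (radial_curv m t) 0 * m t \<partial>lborel)"

definition neg_total_curv :: "(real \<Rightarrow> real) \<Rightarrow> real" where
  "neg_total_curv m = 2 * pi * (\<integral>t\<in>{0<..}. min (radial_curv m t) 0 * m t \<partial>lborel)"

definition finite_total_curv :: "(real \<Rightarrow> real) \<Rightarrow> bool" where
  "finite_total_curv m \<longleftrightarrow>
     set_integrable lborel {0<..} (\<lambda>t. max (radial_curv m t) 0 * m t) \<and>
     set_integrable lborel {0<..} (\<lambda>t. min (radial_curv m t) 0 * m t)"

definition total_curv :: "(real \<Rightarrow> real) \<Rightarrow> real" where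
  "total_curv m = pos_total_curv m + neg_total_curv m"

end

theory Submission
  imports Defs "HOL-Computational_Algebra.Polynomial"
begin

text \<open>
  Since \<open>2 * pi * f'(\<infinity>) = 2 * pi - c > 0\<close>, the function \<open>f\<close> grows linearly and \<open>1/f\<^sup>2\<close> is
  integrable at infinity. No differential equation has to be solved: put \<open>m = f * u\<close> with
  \<open>(f\<^sup>2 u')' = \<psi>\<close> and \<open>u = 1\<close> near \<open>0\<close>, where \<open>\<psi> \<ge> 0\<close> can be chosen freely. Then
  \<open>m'' = f'' u + \<psi>/f\<close>, so the curvature drops by exactly \<open>\<psi>/(f\<^sup>2 u)\<close>. Taking for \<open>\<psi>\<close> a train of
  ever taller and much thinner smooth spikes makes the integrals of \<open>\<psi>\<close> and \<open>\<psi>\<^sup>2\<close> arbitrarily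
  small, hence \<open>u\<close> uniformly close to \<open>1\<close>, while the curvature is unbounded below along the spikes.
\<close>

section \<open>Smooth functions on the line\<close>

text \<open>By induction every iterated derivative of \<open>f\<close> agrees on \<open>S\<close>
  with some member of \<open>C\<close>; as \<open>S\<close> is open, agreement on \<open>S\<close>
  carries over to derivatives. Smoothness thus reduces to finding a class that contains
  \<open>f\<close> and is stable under one differentiation.\<close>

lemma smooth_onI_closed_class:
  assumes "open S" "f \<in> C"
    and closed: "\<And>g. g \<in> C \<Longrightarrow> \<exists>g'\<in>C. \<forall>x\<in>S. (g has_real_derivative g' x) (at x)"
  shows "smooth_on S f"
proof -
  have *: "\<exists>g\<in>C. \<forall>x\<in>S. (deriv ^^ n) f x = g x" for n
  proof (induction n)
    case (Suc n)
    then obtain g where g: "g \<in> C" "\<forall>x\<in>S. (deriv ^^ n) f x = g x" by blast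
    obtain g' where g': "g' \<in> C" "\<forall>x\<in>S. (g has_real_derivative g' x) (at x)"
      using closed g(1) by blast
    have "(deriv ^^ Suc n) f x = g' x" if "x \<in> S" for x
    proof -
      have "((deriv ^^ n) f has_real_derivative g' x) (at x)"
        by (rule has_field_derivative_transform_within_open[OF g'(2)[rule_format, OF that] assms(1) that])
          (simp add: g(2))
      then show ?thesis by (simp add: DERIV_imp_deriv)
    qed
    then show ?case using g'(1) by blast
  qed (use assms(2) in auto)
  show ?thesis
    unfolding smooth_on_def
  proof (intro allI ballI)
    fix n x assume x: "x \<in> S"
    obtain g where g: "g \<in> C" "\<forall>x\<in>S. (deriv ^^ n) f x = g x" using * by blast
    obtain g' where g': "\<forall>x\<in>S. (g has_real_derivative g' x) (at x)"
      using closed[OF g(1)] by blast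
    have "((deriv ^^ n) f has_real_derivative g' x) (at x)"
      by (rule has_field_derivative_transform_within_open[OF g'[rule_format, OF x] assms(1) x])
        (simp add: g(2))
    then show "(deriv ^^ n) f differentiable at x"
      by (auto simp: real_differentiable_def)
  qed
qed

lemma smooth_on_deriv: "smooth_on S f \<Longrightarrow> smooth_on S (deriv f)"
  unfolding smooth_on_def by (metis comp_apply funpow_Suc_right)

lemma smooth_on_DERIV:
  assumes "smooth_on S f" "x \<in> S"
  shows "(f has_real_derivative deriv f x) (at x)"
proof -
  have "(deriv ^^ 0) f differentiable at x" using assms unfolding smooth_on_def by blast
  then show ?thesis by (simp add: DERIV_deriv_iff_real_differentiable)
qed

lemma smooth_on_continuous_on: "smooth_on S f \<Longrightarrow> continuous_on S f"
  by (auto intro!: continuous_at_imp_continuous_on DERIV_isCont smooth_on_DERIV)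

lemma smooth_on_subset: "smooth_on S f \<Longrightarrow> T \<subseteq> S \<Longrightarrow> smooth_on T f"
  unfolding smooth_on_def by blast

text \<open>Adjoining \<open>f\<close> to the smooth functions keeps that class closed under
  differentiation. This handles functions defined by integrals, where only the first derivative is
  known.\<close>

lemma smooth_on_antideriv:
  assumes "open S" "smooth_on S g" "\<And>x. x \<in> S \<Longrightarrow> (f has_real_derivative g x) (at x)"
  shows "smooth_on S f"
proof (rule smooth_onI_closed_class[where C = "insert f {g. smooth_on S g}"])
  fix h assume "h \<in> insert f {g. smooth_on S g}"
  then show "\<exists>g'\<in>insert f {g. smooth_on S g}. \<forall>x\<in>S. (h has_real_derivative g' x) (at x)"
  proof
    assume "h = f"
    then show ?thesis using assms by (intro bexI[of _ g]) auto
  next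
    assume "h \<in> {g. smooth_on S g}"
    then show ?thesis
      by (intro bexI[of _ "deriv h"]) (auto intro: smooth_on_deriv smooth_on_DERIV)
  qed
qed (use assms in auto)

text \<open>Near each point \<open>f\<close> is an antiderivative of the smooth function
  \<open>deriv g\<close>. Needed for gluing: the spike train is defined piecewise through the floor
  function.\<close>

lemma smooth_on_local:
  assumes "\<And>x. x \<in> S \<Longrightarrow> \<exists>U g. open U \<and> x \<in> U \<and> smooth_on U g \<and> (\<forall>y\<in>U. f y = g y)"
  shows "smooth_on S f"
  unfolding smooth_on_def
proof (intro allI ballI)
  fix n x assume "x \<in> S"
  then obtain U g where U: "open U" "x \<in> U" "smooth_on U g" "\<forall>y\<in>U. f y = g y"
    using assms by metis
  have "smooth_on U f"
  proof (rule smooth_on_antideriv[OF U(1) smooth_on_deriv[OF U(3)]])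
    show "(f has_real_derivative deriv g y) (at y)" if "y \<in> U" for y
      using has_field_derivative_transform_within_open[OF smooth_on_DERIV[OF U(3) that] U(1) that]
        U(4) by simp
  qed
  then show "(deriv ^^ n) f differentiable at x" using U unfolding smooth_on_def by blast
qed

text \<open>This class is closed under differentiation, which spares the Leibniz and Faa di Bruno
  formulas for higher derivatives of products and compositions.\<close>
inductive_set smooth_alg :: "real set \<Rightarrow> (real \<Rightarrow> real) set" for S where
  base: "smooth_on S f \<Longrightarrow> f \<in> smooth_alg S"
| add: "f \<in> smooth_alg S \<Longrightarrow> g \<in> smooth_alg S \<Longrightarrow> (\<lambda>x. f x + g x) \<in> smooth_alg S"
| mult: "f \<in> smooth_alg S \<Longrightarrow> g \<in> smooth_alg S \<Longrightarrow> (\<lambda>x. f x * g x) \<in> smooth_alg S"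
| comp: "smooth_on T h \<Longrightarrow> smooth_on S g \<Longrightarrow> g ` S \<subseteq> T \<Longrightarrow> (\<lambda>x. h (g x)) \<in> smooth_alg S"

lemma smooth_alg_smooth_on:
  assumes "open S" "f \<in> smooth_alg S"
  shows "smooth_on S f"
proof (rule smooth_onI_closed_class[OF assms])
  fix g assume "g \<in> smooth_alg S"
  then show "\<exists>g'\<in>smooth_alg S. \<forall>x\<in>S. (g has_real_derivative g' x) (at x)"
  proof induction
    case (base f)
    then show ?case
      by (intro bexI[of _ "deriv f"])
        (auto intro: smooth_alg.base smooth_on_deriv smooth_on_DERIV)
  next
    case (add f g)
    then obtain f' g' where "f' \<in> smooth_alg S" "g' \<in> smooth_alg S"
      "\<forall>x\<in>S. (f has_real_derivative f' x) (at x)" "\<forall>x\<in>S. (g has_real_derivative g' x) (at x)"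
      by blast
    then show ?case
      by (intro bexI[of _ "\<lambda>x. f' x + g' x"]) (auto intro: smooth_alg.add DERIV_add)
  next
    case (mult f g)
    then obtain f' g' where fg: "f' \<in> smooth_alg S" "g' \<in> smooth_alg S"
      "\<forall>x\<in>S. (f has_real_derivative f' x) (at x)" "\<forall>x\<in>S. (g has_real_derivative g' x) (at x)"
      by blast
    have "(\<lambda>x. f' x * g x + g' x * f x) \<in> smooth_alg S"
      by (intro smooth_alg.add smooth_alg.mult fg mult)
    moreover have "((\<lambda>x. f x * g x) has_real_derivative f' x * g x + g' x * f x) (at x)"
      if "x \<in> S" for x
      using fg(3,4) that by (intro DERIV_mult) simp_all
    ultimately show ?case by (intro bexI[of _ "\<lambda>x. f' x * g x + g' x * f x"]) simp_all
  next
    \<comment> \<open>Because \<open>comp\<close> takes smooth functions rather than members of the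
      algebra, the chain rule stays inside: \<open>deriv h (g x)\<close> is again a
      \<open>comp\<close> and \<open>deriv g x\<close> a \<open>base\<close>.\<close>
    case (comp T h g)
    have "(\<lambda>x. deriv h (g x)) \<in> smooth_alg S"
      by (rule smooth_alg.comp[OF smooth_on_deriv]) (use comp in auto)
    then have "(\<lambda>x. deriv h (g x) * deriv g x) \<in> smooth_alg S"
      by (rule smooth_alg.mult[OF _ smooth_alg.base[OF smooth_on_deriv[OF comp(2)]]])
    moreover have "((\<lambda>x. h (g x)) has_real_derivative deriv h (g x) * deriv g x) (at x)"
      if "x \<in> S" for x
      using comp that
      by (intro DERIV_chain2[of h] smooth_on_DERIV[of T h] smooth_on_DERIV[of S g]) auto
    ultimately show ?case
      by (intro bexI[of _ "\<lambda>x. deriv h (g x) * deriv g x"]) simp_all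
  qed
qed

lemma smooth_on_mult:
  "open S \<Longrightarrow> smooth_on S f \<Longrightarrow> smooth_on S g \<Longrightarrow> smooth_on S (\<lambda>x. f x * g x)"
  by (rule smooth_alg_smooth_on[OF _ smooth_alg.mult[OF smooth_alg.base smooth_alg.base]])

lemma smooth_on_compose:
  assumes "open S" "smooth_on T h" "smooth_on S g" "g ` S \<subseteq> T"
  shows "smooth_on S (\<lambda>x. h (g x))"
  by (rule smooth_alg_smooth_on[OF assms(1) smooth_alg.comp[OF assms(2-4)]])

lemma smooth_on_poly: "open S \<Longrightarrow> smooth_on S (poly p)"
  by (rule smooth_onI_closed_class[where C = "range poly"]) (auto intro: poly_DERIV)

lemma smooth_on_const: "open S \<Longrightarrow> smooth_on S (\<lambda>x. c)"
  by (rule smooth_on_antideriv[OF _ smooth_on_poly[of S 0]]) auto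

text \<open>The derivative of \<open>p(1/x)\<close> is \<open>-(1/x)\<^sup>2 p'(1/x)\<close>, so
  polynomials in \<open>1/x\<close> form a class closed under differentiation.\<close>

lemma smooth_on_inverse: "smooth_on {0<..} inverse"
proof (rule smooth_onI_closed_class[where C = "range (\<lambda>p x. poly p (inverse x))"])
  show "(inverse :: real \<Rightarrow> real) \<in> range (\<lambda>p x. poly p (inverse x))"
    by (rule image_eqI[of _ _ "[:0, 1:]"]) auto
next
  fix g :: "real \<Rightarrow> real" assume "g \<in> range (\<lambda>p x. poly p (inverse x))"
  then obtain p where g: "g = (\<lambda>x. poly p (inverse x))" by blast
  have "(g has_real_derivative poly ([:0, 0, -1:] * pderiv p) (inverse x)) (at x)"
    if "x > 0" for x
    unfolding g using that
    by (auto intro!: derivative_eq_intros DERIV_chain2[OF poly_DERIV] simp: power2_eq_square)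
  then show "\<exists>g'\<in>range (\<lambda>p x. poly p (inverse x)).
      \<forall>x\<in>{0<..}. (g has_real_derivative g' x) (at x)"
    by (intro bexI[of _ "\<lambda>x. poly ([:0, 0, -1:] * pderiv p) (inverse x)"]) blast+
qed auto

section \<open>Flat functions and a smooth bump\<close>

definition flat_poly :: "real poly \<Rightarrow> real \<Rightarrow> real" where
  "flat_poly p x = (if x > 0 then poly p (inverse x) * exp (- inverse x) else 0)"

text \<open>With \<open>y = 1/x\<close> this is the decay of a polynomial against
  \<open>exp (- y)\<close> as \<open>y\<close> tends to \<infinity>.\<close>

lemma flat_poly_tendsto_0:
  fixes p :: "real poly"
  shows "((\<lambda>x. poly p (inverse x) * exp (- inverse x)) \<longlongrightarrow> 0) (at_right 0)"
proof -
  have "((\<lambda>x. poly p x * exp (- x)) \<longlongrightarrow> 0) at_top"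
  proof -
    have "((\<lambda>x::real. \<Sum>i\<le>degree p. coeff p i * (x ^ i / exp x)) \<longlongrightarrow> (\<Sum>i\<le>degree p. coeff p i * 0)) at_top"
      by (intro tendsto_sum tendsto_mult tendsto_const tendsto_power_div_exp_0)
    then show ?thesis
      by (simp add: poly_altdef sum_distrib_right exp_minus divide_inverse mult.assoc)
  qed
  then show ?thesis
    by (rule filterlim_compose[OF _ filterlim_inverse_at_top_right])
qed

text \<open>The polynomial factor is carried along so that the family is closed under
  differentiation: with \<open>y = 1/x\<close> one has \<open>dy/dx = -y\<^sup>2\<close>, which
  yields the factor \<open>y\<^sup>2 (p - p')\<close>. At \<open>0\<close> the right difference
  quotient has the same form with \<open>y p(y)\<close> in place of \<open>p(y)\<close>, hence tends
  to \<open>0\<close>.\<close>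

lemma flat_poly_DERIV:
  "(flat_poly p has_real_derivative flat_poly ([:0, 0, 1:] * (p - pderiv p)) x) (at x)"
proof (cases x "0 :: real" rule: linorder_cases)
  case less
  have "((\<lambda>x. 0) has_real_derivative 0) (at x)" by simp
  then have "(flat_poly p has_real_derivative 0) (at x)"
    by (rule has_field_derivative_transform_within_open[of _ _ _ "{..<0}"])
      (use less in \<open>auto simp: flat_poly_def\<close>)
  then show ?thesis using less by (simp add: flat_poly_def)
next
  case equal
  have "((\<lambda>h. flat_poly p h / h) \<longlongrightarrow> 0) (at_right 0)"
    by (rule tendsto_cong[THEN iffD2, OF _ flat_poly_tendsto_0[of "[:0, 1:] * p"]])
      (auto simp: eventually_at_filter flat_poly_def divide_inverse)
  moreover have "((\<lambda>h. flat_poly p h / h) \<longlongrightarrow> 0) (at_left 0)"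
    by (rule tendsto_eventually) (auto simp: eventually_at_filter flat_poly_def)
  ultimately have "((\<lambda>h. flat_poly p h / h) \<longlongrightarrow> 0) (at 0)"
    by (simp add: filterlim_split_at)
  then show ?thesis
    unfolding equal DERIV_def by (simp add: flat_poly_def)
next
  case greater
  have "((\<lambda>x. poly p (inverse x) * exp (- inverse x)) has_real_derivative
      flat_poly ([:0, 0, 1:] * (p - pderiv p)) x) (at x)"
    using greater
    by (auto intro!: derivative_eq_intros DERIV_chain2[OF poly_DERIV]
        simp: flat_poly_def power2_eq_square algebra_simps)
  then show ?thesis
    by (rule has_field_derivative_transform_within_open[of _ _ _ "{0<..}"])
      (use greater in \<open>auto simp: flat_poly_def\<close>)
qed

lemma smooth_on_flat_poly: "smooth_on UNIV (flat_poly p)"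
  by (rule smooth_onI_closed_class[where C = "range flat_poly"]) (auto intro: flat_poly_DERIV)

lemma smooth_bump_exists:
  obtains b :: "real \<Rightarrow> real" where "smooth_on UNIV b" "\<And>x. 0 \<le> b x" "\<And>x. b x \<le> 1" "b 0 = 1"
    "\<And>x. \<bar>x\<bar> \<ge> 1 \<Longrightarrow> b x = 0"
proof
  \<comment> \<open>The classical bump \<open>exp (1 - 1/(1 - x\<^sup>2))\<close>; the factor
    \<open>exp 1\<close> normalises its maximum to \<open>1\<close>.\<close>
  let ?b = "\<lambda>x. exp 1 * flat_poly [:1:] (poly [:1, 0, -1:] x)"
  show "smooth_on UNIV ?b"
    by (rule smooth_on_mult[OF open_UNIV smooth_on_const[OF open_UNIV]
        smooth_on_compose[OF open_UNIV smooth_on_flat_poly smooth_on_poly[OF open_UNIV]]]) simp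
  show "0 \<le> ?b x" for x by (simp add: flat_poly_def)
  show "?b x \<le> 1" for x
  proof (cases "1 - x * x > 0")
    case True
    then have "inverse (1 - x * x) \<ge> 1" by (simp add: one_le_inverse_iff)
    then show ?thesis using True by (simp add: flat_poly_def mult_exp_exp)
  qed (simp add: flat_poly_def)
  show "?b 0 = 1" by (simp add: flat_poly_def mult_exp_exp)
  show "?b x = 0" if "\<bar>x\<bar> \<ge> 1" for x
  proof -
    have "x * x \<ge> 1" using mult_mono[OF that that] by simp
    then show ?thesis by (simp add: flat_poly_def)
  qed
qed

section \<open>Spike trains\<close>

text \<open>The function \<open>g\<close> is dominated by a series of step functions, the
  \<open>n\<close>-th of mass at most \<open>\<eta> / 2 ^ Suc n\<close>. Nonnegative integrals allow
  series and integral to be exchanged before integrability of \<open>g\<close> is known.\<close>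

lemma integral_le_of_spikes:
  fixes g :: "real \<Rightarrow> real"
  assumes meas[measurable]: "g \<in> borel_measurable borel" and nonneg: "\<And>t. 0 \<le> g t"
    and bound: "\<And>t. g t \<noteq> 0 \<Longrightarrow> \<exists>n::nat. t \<in> {p n - r n .. p n + r n} \<and> g t \<le> c n"
    and c: "\<And>n. 0 \<le> c n" and r: "\<And>n. 0 \<le> r n"
    and small: "\<And>n. c n * (2 * r n) \<le> \<eta> * (1/2) ^ Suc n" and "\<eta> > 0"
  shows "integrable lborel g" "(\<integral>t. g t \<partial>lborel) \<le> \<eta>"
proof -
  define A where "A n = {p n - r n .. p n + r n}" for n
  have [measurable]: "A n \<in> sets borel" for n by (simp add: A_def)
  have "(\<integral>\<^sup>+t. ennreal (g t) \<partial>lborel) \<le> (\<integral>\<^sup>+t. (\<Sum>n. ennreal (c n) * indicator (A n) t) \<partial>lborel)"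
  proof (rule nn_integral_mono)
    fix t
    show "ennreal (g t) \<le> (\<Sum>n. ennreal (c n) * indicator (A n) t)"
    proof (cases "g t = 0")
      case False
      then obtain n where n: "t \<in> A n" "g t \<le> c n" using bound unfolding A_def by blast
      have "ennreal (g t) \<le> ennreal (c n) * indicator (A n) t"
        using n by (simp add: ennreal_leI)
      also have "\<dots> \<le> (\<Sum>n. ennreal (c n) * indicator (A n) t)"
        using sum_le_suminf[of "\<lambda>n. ennreal (c n) * indicator (A n) t" "{n}"]
        by (simp del: sum_mult_indicator)
      finally show ?thesis .
    qed simp
  qed
  also have "\<dots> = (\<Sum>n. \<integral>\<^sup>+t. ennreal (c n) * indicator (A n) t \<partial>lborel)"
    by (rule nn_integral_suminf) measurable
  also have "\<dots> = (\<Sum>n. ennreal (c n * (2 * r n)))"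
    using c r by (simp add: nn_integral_cmult_indicator A_def ennreal_mult)
  also have "\<dots> \<le> (\<Sum>n. ennreal (\<eta> * (1/2) ^ Suc n))"
    by (intro suminf_le ennreal_leI small) auto
  also have "\<dots> = ennreal \<eta>"
    using sums_mult[OF power_half_series, of \<eta>] \<open>\<eta> > 0\<close>
    by (subst suminf_ennreal2) (auto simp: sums_iff)
  finally have *: "(\<integral>\<^sup>+t. ennreal (g t) \<partial>lborel) \<le> ennreal \<eta>" .
  then show int: "integrable lborel g"
    using nonneg by (intro integrableI_nonneg) (auto simp: le_less_trans)
  have "ennreal (\<integral>t. g t \<partial>lborel) \<le> ennreal \<eta>"
    using * nonneg by (subst nn_integral_eq_integral[OF int, symmetric]) auto
  then show "(\<integral>t. g t \<partial>lborel) \<le> \<eta>"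
    using \<open>\<eta> > 0\<close> by simp
qed

text \<open>Heights may be prescribed at will, since the width of each spike is free to compensate.
  Each unit interval starting at an integer \<open>n\<close> with \<open>T \<le> n\<close> carries
  one rescaled bump about its midpoint.\<close>

lemma smooth_spikes_exist:
  fixes h :: "nat \<Rightarrow> real"
  assumes h: "\<And>n. 0 \<le> h n" and "0 \<le> T" "0 < \<eta>"
  obtains \<psi> :: "real \<Rightarrow> real" where "smooth_on UNIV \<psi>" "\<And>t. 0 \<le> \<psi> t"
    "\<And>t. t \<le> T \<Longrightarrow> \<psi> t = 0" "\<And>n. T \<le> real n \<Longrightarrow> \<psi> (real n + 1/2) = h n"
    "integrable lborel \<psi>" "(\<integral>t. \<psi> t \<partial>lborel) \<le> \<eta>"
    "integrable lborel (\<lambda>t. (\<psi> t)\<^sup>2)" "(\<integral>t. (\<psi> t)\<^sup>2 \<partial>lborel) \<le> \<eta>"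
proof -
  obtain b :: "real \<Rightarrow> real" where b: "smooth_on UNIV b" "\<And>x. 0 \<le> b x" "\<And>x. b x \<le> 1" "b 0 = 1"
    "\<And>x. \<bar>x\<bar> \<ge> 1 \<Longrightarrow> b x = 0"
    using smooth_bump_exists by blast
  \<comment> \<open>The half-width of spike \<open>n\<close> is \<open>1 / N n\<close>. The summand
    4 confines the spike to the middle half of its unit interval; the other summand makes the mass
    small for heights \<open>h n\<close> and \<open>(h n)\<^sup>2\<close> at once.\<close>
  define N where "N n = 4 + 2 * (h n + (h n)\<^sup>2) * 2 ^ Suc n / \<eta>" for n
  have N4: "N n \<ge> 4" for n using h[of n] \<open>0 < \<eta>\<close> by (simp add: N_def)
  have small: "x * (2 * (1 / N n)) \<le> \<eta> * (1/2) ^ Suc n" if "x \<le> h n + (h n)\<^sup>2" for x n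
  proof -
    have "2 * x * 2 ^ Suc n / \<eta> \<le> 2 * (h n + (h n)\<^sup>2) * 2 ^ Suc n / \<eta>"
      using that \<open>0 < \<eta>\<close> by (intro divide_right_mono mult_right_mono) auto
    also have "\<dots> \<le> N n" by (simp add: N_def)
    finally have "2 * x * 2 ^ Suc n \<le> N n * \<eta>" using \<open>0 < \<eta>\<close> by (simp add: pos_divide_le_eq)
    then show ?thesis using N4[of n] by (simp add: field_simps)
  qed
  define H where "H k = (if T \<le> of_int k then h (nat k) else 0)" for k
  define \<psi> where
    "\<psi> t = H \<lfloor>t\<rfloor> * b (N (nat \<lfloor>t\<rfloor>) * (t - of_int \<lfloor>t\<rfloor> - 1/2))" for t
  have H0: "0 \<le> H k" for k using h by (simp add: H_def)
  have b0: "b (N n * x) = 0" if "\<bar>x\<bar> \<ge> 1 / N n" for n x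
  proof (rule b(5))
    have "N n * (1 / N n) \<le> N n * \<bar>x\<bar>" using that N4[of n] by (intro mult_left_mono) auto
    then show "1 \<le> \<bar>N n * x\<bar>" using N4[of n] by (simp add: abs_mult)
  qed
  have b0': "b (N n * x) = 0" if "\<bar>x\<bar> \<ge> 1/4" for n x
  proof (rule b0)
    have "1 / N n \<le> 1/4" using N4[of n] by (intro divide_left_mono) auto
    then show "\<bar>x\<bar> \<ge> 1 / N n" using that by linarith
  qed
  have smooth: "smooth_on UNIV \<psi>"
  proof (rule smooth_on_local)
    fix t :: real
    let ?k = "\<lfloor>t\<rfloor>"
    show "\<exists>U g. open U \<and> t \<in> U \<and> smooth_on U g \<and> (\<forall>y\<in>U. \<psi> y = g y)"
    \<comment> \<open>The floor jumps only at integers, and within 1/4 of them the spikes on both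
      sides vanish. Elsewhere it is locally constant, leaving one bump with an affine
      argument.\<close>
    proof (cases "t = of_int ?k")
      case True
      have "\<psi> y = 0" if "y \<in> {of_int ?k - 1/4 <..< of_int ?k + 1/4}" for y
      proof -
        have "\<bar>y - of_int \<lfloor>y\<rfloor> - 1/2\<bar> \<ge> 1/4"
        proof (cases "of_int ?k \<le> y")
          case True
          then have "\<lfloor>y\<rfloor> = ?k" using that by (intro floor_unique) auto
          then show ?thesis using that True by auto
        next
          case False
          then have "\<lfloor>y\<rfloor> = ?k - 1" using that by (intro floor_unique) auto
          then show ?thesis using that False by auto
        qed
        then show ?thesis by (simp add: \<psi>_def b0')
      qed
      then show ?thesis using True
        by (intro exI[of _ "{of_int ?k - 1/4 <..< of_int ?k + 1/4}"] exI[of _ "\<lambda>_. 0"])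
          (auto intro: smooth_on_const)
    next
      case False
      let ?U = "{of_int ?k <..< of_int ?k + 1 :: real}"
      let ?N = "N (nat ?k)"
      let ?g = "\<lambda>y. H ?k * b (poly [:- ?N * (of_int ?k + 1/2), ?N:] y)"
      have "smooth_on ?U ?g"
        by (rule smooth_on_mult[OF _ smooth_on_const smooth_on_compose[OF _ b(1) smooth_on_poly]]) auto
      moreover have "\<psi> y = ?g y" if "y \<in> ?U" for y
      proof -
        have "\<lfloor>y\<rfloor> = ?k" using that by (intro floor_unique) auto
        then show ?thesis by (simp add: \<psi>_def algebra_simps)
      qed
      moreover have "of_int ?k < t" "t < of_int ?k + 1" using False by linarith+
      ultimately show ?thesis
        by (intro exI[of _ ?U] exI[of _ ?g]) auto
    qed
  qed
  have nonneg: "0 \<le> \<psi> t" for t using b(2) H0 by (simp add: \<psi>_def)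
  have zero: "\<psi> t = 0" if "t \<le> T" for t
  proof (cases "T \<le> of_int \<lfloor>t\<rfloor>")
    case True
    \<comment> \<open>Here \<open>\<lfloor>t\<rfloor> \<le> t \<le> T \<le>
      \<lfloor>t\<rfloor>\<close>, so \<open>t\<close> is the integer \<open>T\<close>, half a unit
      away from the centre of the spike.\<close>
    then have "t - of_int \<lfloor>t\<rfloor> - 1/2 = - 1/2" using that by linarith
    then show ?thesis using b0'[of "-1/2"] by (simp add: \<psi>_def)
  qed (simp add: \<psi>_def H_def)
  have val: "\<psi> (real n + 1/2) = h n" if "T \<le> real n" for n
  proof -
    have "\<lfloor>real n + 1/2\<rfloor> = int n" by (intro floor_unique) auto
    then show ?thesis using that b(4) by (simp add: \<psi>_def H_def)
  qed
  have supp: "t \<in> {real n + 1/2 - 1 / N n .. real n + 1/2 + 1 / N n} \<and> \<psi> t \<le> h n"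
    if "\<psi> t \<noteq> 0" "n = nat \<lfloor>t\<rfloor>" for t n
  proof -
    have T: "T \<le> of_int \<lfloor>t\<rfloor>" using that(1) by (auto simp: \<psi>_def H_def split: if_splits)
    then have n: "real n = of_int \<lfloor>t\<rfloor>" using that(2) \<open>0 \<le> T\<close> by simp
    have "\<psi> t = h n * b (N n * (t - real n - 1/2))"
      using T n that(2) by (simp add: \<psi>_def H_def)
    moreover from this have "\<bar>t - real n - 1/2\<bar> < 1 / N n"
      using that(1) b0[of n "t - real n - 1/2"] by (intro not_le_imp_less) auto
    moreover have "h n * b (N n * (t - real n - 1/2)) \<le> h n * 1"
      using b(3) h by (intro mult_left_mono)
    ultimately show ?thesis by auto
  qed
  have [measurable]: "\<psi> \<in> borel_measurable borel"
    by (intro borel_measurable_continuous_onI smooth_on_continuous_on smooth)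
  have rN: "0 \<le> 1 / N n" for n using N4[of n] by simp
  have s1: "\<exists>n. t \<in> {real n + 1/2 - 1 / N n .. real n + 1/2 + 1 / N n} \<and> \<psi> t \<le> h n"
    if "\<psi> t \<noteq> 0" for t
    using supp[OF that refl] by blast
  have s2: "\<exists>n. t \<in> {real n + 1/2 - 1 / N n .. real n + 1/2 + 1 / N n} \<and> (\<psi> t)\<^sup>2 \<le> (h n)\<^sup>2"
    if "(\<psi> t)\<^sup>2 \<noteq> 0" for t
    using supp[of t "nat \<lfloor>t\<rfloor>"] that power_mono[OF _ nonneg[of t], of _ 2]
    by (intro exI[of _ "nat \<lfloor>t\<rfloor>"]) simp
  have m2: "(\<lambda>t. (\<psi> t)\<^sup>2) \<in> borel_measurable borel" by measurable
  have small1: "h n * (2 * (1 / N n)) \<le> \<eta> * (1/2) ^ Suc n" for n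
    by (rule small) simp
  have small2: "(h n)\<^sup>2 * (2 * (1 / N n)) \<le> \<eta> * (1/2) ^ Suc n" for n
    by (rule small) (simp add: h)
  note 1 = integral_le_of_spikes[OF \<open>\<psi> \<in> borel_measurable borel\<close> nonneg s1 h rN small1 \<open>0 < \<eta>\<close>]
  note 2 = integral_le_of_spikes[OF m2 zero_le_power2 s2 zero_le_power2 rN small2 \<open>0 < \<eta>\<close>]
  show ?thesis by (rule that[OF smooth nonneg zero val 1 2])
qed

section \<open>Model surfaces\<close>

lemma model_fun_positive: "model_fun m \<Longrightarrow> 0 < t \<Longrightarrow> 0 < m t"
  by (simp add: model_fun_def)

lemma model_fun_smooth_on: "model_fun m \<Longrightarrow> smooth_on {0<..} m"
  by (simp add: model_fun_def)

text \<open>The positive and negative parts add up to the curvature, and curvature times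
  \<open>m\<close> is \<open>-m''\<close>.\<close>

lemma finite_total_curv_imp_integrable:
  assumes "model_fun m" "finite_total_curv m"
  shows "set_integrable lborel {0<..} (deriv (deriv m))"
proof -
  have "set_integrable lborel {0<..} (\<lambda>t. - (max (radial_curv m t) 0 * m t + min (radial_curv m t) 0 * m t))"
    using integrable_minus[OF Bochner_Integration.integrable_add[OF
        assms(2)[unfolded finite_total_curv_def set_integrable_def, THEN conjunct1]
        assms(2)[unfolded finite_total_curv_def set_integrable_def, THEN conjunct2]]]
    unfolding set_integrable_def scaleR_minus_right scaleR_add_right .
  also have "?this \<longleftrightarrow> ?thesis"
  proof (rule set_integrable_cong[OF refl refl])
    fix t :: real assume "t \<in> {0<..}"
    then show "- (max (radial_curv m t) 0 * m t + min (radial_curv m t) 0 * m t) = deriv (deriv m) t"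
      using model_fun_positive[OF assms(1), of t]
      by (auto simp: radial_curv_def max_def min_def)
  qed
  finally show ?thesis .
qed

text \<open>Converse direction: as \<open>m > 0\<close>, the factor \<open>m\<close> moves inside
  \<open>max\<close> and \<open>min\<close>, so the two integrands are the positive and negative
  parts of \<open>-m''\<close>.\<close>

lemma total_curv_eq_integral:
  assumes "model_fun m" and int: "set_integrable lborel {0<..} (deriv (deriv m))"
  shows "finite_total_curv m"
    and "total_curv m = - 2 * pi * (LINT t:{0<..}|lborel. deriv (deriv m) t)"
proof -
  let ?g = "\<lambda>t. indicator {0<..} t *\<^sub>R deriv (deriv m) t"
  have g: "integrable lborel ?g" using int unfolding set_integrable_def .
  have K: "radial_curv m t * m t = - deriv (deriv m) t" if "0 < t" for t
    using model_fun_positive[OF assms(1) that] by (simp add: radial_curv_def)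
  have mx: "(\<lambda>t. indicator {0<..} t *\<^sub>R (max (radial_curv m t) 0 * m t)) = (\<lambda>t. max (- ?g t) 0)"
    and mn: "(\<lambda>t. indicator {0<..} t *\<^sub>R (min (radial_curv m t) 0 * m t)) = (\<lambda>t. min (- ?g t) 0)"
    using model_fun_positive[OF assms(1)] K
    by (auto simp: fun_eq_iff indicator_def max_mult_distrib_right min_mult_distrib_right less_imp_le)
  have i1: "integrable lborel (\<lambda>t. max (- ?g t) 0)" and i2: "integrable lborel (\<lambda>t. min (- ?g t) 0)"
    using g by (auto intro!: integrable_max integrable_min)
  show "finite_total_curv m"
    unfolding finite_total_curv_def set_integrable_def mx mn using i1 i2 by blast
  have "total_curv m = 2 * pi * ((\<integral>t. max (- ?g t) 0 \<partial>lborel) + (\<integral>t. min (- ?g t) 0 \<partial>lborel))"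
    unfolding total_curv_def pos_total_curv_def neg_total_curv_def set_lebesgue_integral_def mx mn
    by (simp only: distrib_left)
  also have "\<dots> = 2 * pi * (\<integral>t. max (- ?g t) 0 + min (- ?g t) 0 \<partial>lborel)"
    by (simp only: Bochner_Integration.integral_add[OF i1 i2])
  also have "(\<lambda>t. max (- ?g t) 0 + min (- ?g t) 0) = (\<lambda>t. - ?g t)" by (auto simp: fun_eq_iff)
  finally show "total_curv m = - 2 * pi * (LINT t:{0<..}|lborel. deriv (deriv m) t)"
    by (simp add: set_lebesgue_integral_def)
qed

text \<open>Right of \<open>0\<close> the derivative of \<open>m\<close> is that of the smooth odd
  extension, which is continuous with value \<open>1\<close> at \<open>0\<close>. Only a one-sided
  limit makes sense, since \<open>m\<close> is constrained on positive arguments alone.\<close>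

lemma model_fun_deriv_tendsto_1:
  assumes "model_fun m"
  shows "(deriv m \<longlongrightarrow> 1) (at_right 0)"
proof -
  obtain g \<delta> where g: "\<delta> > 0" "smooth_on {-\<delta><..<\<delta>} g" "\<forall>t\<in>{0<..<\<delta>}. g t = m t" "deriv g 0 = 1"
    using assms unfolding model_fun_def by blast
  have "isCont (deriv g) 0"
    using smooth_on_DERIV[OF smooth_on_deriv[OF g(2)], of 0] g(1) DERIV_isCont by auto
  then have "(deriv g \<longlongrightarrow> 1) (at_right 0)"
    using g(4) tendsto_mono[OF at_le[OF subset_UNIV]] unfolding isCont_def by fastforce
  moreover have "eventually (\<lambda>t. deriv g t = deriv m t) (at_right 0)"
  proof -
    have "deriv g t = deriv m t" if "t \<in> {0<..<\<delta>}" for t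
    proof (rule deriv_cong_ev)
      show "eventually (\<lambda>x. g x = m x) (nhds t)"
        using eventually_nhds_in_open[of "{0<..<\<delta>}" t] that g(3) by (auto elim: eventually_mono)
    qed simp
    then show ?thesis
      using g(1) by (intro eventually_at_rightI[of 0 \<delta>]) auto
  qed
  ultimately show ?thesis by (rule Lim_transform_eventually)
qed

text \<open>The fundamental theorem of calculus on \<open>(0,t)\<close>, started from the limit
  \<open>1\<close> at \<open>0\<close>, followed by \<open>t\<close> to \<infinity>. In terms of the
  total curvature \<open>c\<close> the limit is \<open>1 - c / (2 * pi)\<close>.\<close>

lemma model_fun_deriv_tendsto_at_top:
  assumes "model_fun m" and int: "set_integrable lborel {0<..} (deriv (deriv m))"
  shows "(deriv m \<longlongrightarrow> 1 + (LINT t:{0<..}|lborel. deriv (deriv m) t)) at_top"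
proof -
  let ?D = "deriv (deriv m)"
  have sm: "smooth_on {0<..} (deriv m)" "smooth_on {0<..} ?D"
    using model_fun_smooth_on[OF assms(1)] smooth_on_deriv by blast+
  have eq: "deriv m t = 1 + (\<integral>x. indicator {..t} x *\<^sub>R (indicator {0<..} x *\<^sub>R ?D x) \<partial>lborel)" if "t > 0" for t
  proof -
    have "(LBINT x=ereal 0..ereal t. ?D x) = deriv m t - 1"
    proof (rule interval_integral_FTC_integrable)
      show "(deriv m has_vector_derivative ?D x) (at x)" if "ereal 0 < ereal x" for x
        using smooth_on_DERIV[OF sm(1)] that
        by (simp add: has_real_derivative_iff_has_vector_derivative)
      show "isCont ?D x" if "ereal 0 < ereal x" for x
        using smooth_on_DERIV[OF sm(2), of x] that DERIV_isCont by auto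
      show "set_integrable lborel (einterval (ereal 0) (ereal t)) ?D"
        by (rule set_integrable_subset[OF int]) (auto simp: einterval_iff)
      show "((deriv m \<circ> real_of_ereal) \<longlongrightarrow> 1) (at_right (ereal 0))"
        unfolding ereal_tendsto_simps1 by (rule model_fun_deriv_tendsto_1[OF assms(1)])
      have "isCont (deriv m) t"
        using smooth_on_DERIV[OF sm(1), of t] \<open>t > 0\<close> DERIV_isCont by auto
      then show "((deriv m \<circ> real_of_ereal) \<longlongrightarrow> deriv m t) (at_left (ereal t))"
        unfolding ereal_tendsto_simps1 isCont_def by (rule tendsto_mono[OF at_le[OF subset_UNIV]])
    qed (use \<open>t > 0\<close> in auto)
    moreover have "(LBINT x=ereal 0..ereal t. ?D x) = (LINT x:{0<..t}|lborel. ?D x)"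
      using \<open>t > 0\<close> by (intro interval_integral_Ioc) auto
    moreover have "\<dots> = (\<integral>x. indicator {..t} x *\<^sub>R (indicator {0<..} x *\<^sub>R ?D x) \<partial>lborel)"
      unfolding set_lebesgue_integral_def
      by (intro Bochner_Integration.integral_cong) (auto simp: indicator_def)
    ultimately show ?thesis by simp
  qed
  have "((\<lambda>t. 1 + (\<integral>x. indicator {..t} x *\<^sub>R (indicator {0<..} x *\<^sub>R ?D x) \<partial>lborel))
      \<longlongrightarrow> 1 + (LINT t:{0<..}|lborel. ?D t)) at_top"
    unfolding set_lebesgue_integral_def
    using int by (intro tendsto_add tendsto_const tendsto_integral_at_top) (auto simp: set_integrable_def)
  moreover have "eventually (\<lambda>t. 1 + (\<integral>x. indicator {..t} x *\<^sub>R (indicator {0<..} x *\<^sub>R ?D x) \<partial>lborel) = deriv m t) at_top"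
    using eventually_gt_at_top[of 0] by eventually_elim (simp add: eq)
  ultimately show ?thesis by (rule Lim_transform_eventually)
qed

text \<open>Total curvature below \<open>2 * pi\<close> makes the limit of \<open>m'\<close>
  positive; integrating a positive lower bound of \<open>m'\<close> gives the growth.\<close>

lemma model_fun_linear_growth:
  assumes "model_fun m" "finite_total_curv m" "total_curv m < 2 * pi"
  obtains a T where "a > 0" "T > 0" "\<And>t. T \<le> t \<Longrightarrow> a * t \<le> m t"
proof -
  define I where "I = (LINT t:{0<..}|lborel. deriv (deriv m) t)"
  have int: "set_integrable lborel {0<..} (deriv (deriv m))"
    by (rule finite_total_curv_imp_integrable[OF assms(1,2)])
  have "2 * pi * (- I) < 2 * pi * 1"
    using total_curv_eq_integral(2)[OF assms(1) int] assms(3) by (simp add: I_def)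
  then have pos: "1 + I > 0"
    by (subst (asm) mult_less_cancel_left_pos) auto
  \<comment> \<open>Eventually \<open>m' > 2 * a\<close>, so \<open>m t\<close> exceeds
    \<open>2 * a * (t - T1)\<close>, which is at least \<open>a * t\<close> once
    \<open>t \<ge> 2 * T1\<close>.\<close>
  define a where "a = (1 + I) / 4"
  have a: "a > 0" "2 * a < 1 + I" using pos by (auto simp: a_def)
  have "eventually (\<lambda>t. 2 * a < deriv m t) at_top"
    using order_tendstoD(1)[OF model_fun_deriv_tendsto_at_top[OF assms(1) int, folded I_def] a(2)] .
  then obtain T0 where T0: "\<And>t. T0 \<le> t \<Longrightarrow> 2 * a < deriv m t"
    by (auto simp: eventually_at_top_linorder)
  define T1 where "T1 = max T0 1"
  show ?thesis
  proof (rule that[of a "2 * T1"])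
    fix t assume t: "2 * T1 \<le> t"
    have "m T1 - 2 * a * T1 \<le> m t - 2 * a * t"
    proof (rule DERIV_nonneg_imp_nondecreasing[where f = "\<lambda>x. m x - 2 * a * x"])
      show "T1 \<le> t" using t unfolding T1_def by linarith
      fix x assume x: "T1 \<le> x"
      have "((\<lambda>x. m x - 2 * a * x) has_real_derivative deriv m x - 2 * a) (at x)"
        using x by (auto intro!: derivative_eq_intros smooth_on_DERIV[OF model_fun_smooth_on[OF assms(1)]] simp: T1_def)
      then show "\<exists>y. ((\<lambda>x. m x - 2 * a * x) has_real_derivative y) (at x) \<and> 0 \<le> y"
        using T0[of x] x by (intro exI[of _ "deriv m x - 2 * a"]) (auto simp: T1_def)
    qed
    moreover have "m T1 > 0" using model_fun_positive[OF assms(1)] by (simp add: T1_def)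
    moreover have "a * (2 * T1) \<le> a * t" using t a(1) by (intro mult_left_mono) auto
    ultimately show "a * t \<le> m t" by (simp add: algebra_simps)
  qed (use a in \<open>auto simp: T1_def\<close>)
qed

section \<open>Perturbing the warping function\<close>

lemma integral_DERIV:
  fixes g :: "real \<Rightarrow> real"
  assumes "continuous_on {a..} g" "a < t"
  shows "((\<lambda>x. integral {a..x} g) has_real_derivative g t) (at t)"
proof -
  have "((\<lambda>x. integral {a..x} g) has_real_derivative g t) (at t within {a..t+1})"
    using assms by (intro integral_has_real_derivative continuous_on_subset[OF assms(1)]) auto
  moreover have "at t within {a..t+1} = at t"
    using assms(2) by (intro at_within_interior) auto
  ultimately show ?thesis by simp
qed

lemma set_integral_le_integral:
  fixes g :: "real \<Rightarrow> real"
  assumes "integrable lborel g" "\<And>t. 0 \<le> g t" "A \<in> sets borel"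
  shows "set_integrable lborel A g" "(LINT t:A|lborel. g t) \<le> (\<integral>t. g t \<partial>lborel)"
proof -
  show *: "set_integrable lborel A g"
    using assms unfolding set_integrable_def by (intro integrable_mult_indicator) auto
  show "(LINT t:A|lborel. g t) \<le> (\<integral>t. g t \<partial>lborel)"
    using * assms unfolding set_integrable_def set_lebesgue_integral_def
    by (intro integral_mono) (auto simp: indicator_def)
qed

lemma Liminf_at_top_eq_MInf:
  fixes G :: "real \<Rightarrow> real"
  assumes "\<And>B M. \<exists>t\<ge>B. G t \<le> M"
  shows "Liminf at_top (\<lambda>t. ereal (G t)) = -\<infinity>"
proof (rule ccontr)
  assume "\<not> ?thesis"
  then have "-\<infinity> < Liminf at_top (\<lambda>t. ereal (G t))" by simp
  then obtain M where "ereal M < Liminf at_top (\<lambda>t. ereal (G t))" using ereal_dense2 by blast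
  from less_LiminfD[OF this] obtain B where "\<And>t. t \<ge> B \<Longrightarrow> M < G t"
    by (auto simp: eventually_at_top_linorder)
  then show False using assms[of B M] by force
qed

text \<open>Two integrations solve \<open>(f\<^sup>2 u')' = \<psi>\<close>: first
  \<open>w = f\<^sup>2 u'\<close>, then \<open>u\<close>. The bound on \<open>u - 1\<close> is
  \<eta> times the integral of \<open>1/(a t)\<^sup>2\<close> over \<open>t \<ge> T\<close>.\<close>

lemma model_fun_perturbation:
  fixes f \<psi> :: "real \<Rightarrow> real"
  assumes f: "model_fun f" and "a > 0" "T > 0" and growth: "\<forall>t\<ge>T. a * t \<le> f t"
    and \<psi>: "smooth_on UNIV \<psi>" "\<And>t. 0 \<le> \<psi> t" "\<forall>t\<le>T. \<psi> t = 0"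
    and int: "integrable lborel \<psi>" "(\<integral>t. \<psi> t \<partial>lborel) \<le> \<eta>"
  shows "\<exists>u. smooth_on {0<..} u \<and> (\<forall>t>0. 1 \<le> u t) \<and> (\<forall>t>0. u t \<le> 1 + \<eta> * (1 / (a\<^sup>2 * T))) \<and>
    model_fun (\<lambda>t. f t * u t) \<and>
    (\<forall>t>0. deriv (deriv (\<lambda>t. f t * u t)) t = deriv (deriv f) t * u t + \<psi> t / f t)"
proof -
  have fpos: "0 < f t" if "0 < t" for t using model_fun_positive[OF f that] .
  have fsm: "smooth_on {0<..} f" using model_fun_smooth_on[OF f] .
  have fD: "(f has_real_derivative deriv f t) (at t)"
    "(deriv f has_real_derivative deriv (deriv f) t) (at t)" if "0 < t" for t
    using smooth_on_DERIV[OF fsm] smooth_on_DERIV[OF smooth_on_deriv[OF fsm]] that by auto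
  define w where "w t = integral {0..t} \<psi>" for t
  have \<psi>c: "continuous_on S \<psi>" for S
    using smooth_on_continuous_on[OF \<psi>(1)] continuous_on_subset by blast
  have wD: "(w has_real_derivative \<psi> t) (at t)" if "0 < t" for t
    unfolding w_def by (rule integral_DERIV[OF \<psi>c that])
  have wsm: "smooth_on {0<..} w"
    by (rule smooth_on_antideriv[OF _ smooth_on_subset[OF \<psi>(1)]]) (auto intro: wD)
  have w0: "0 \<le> w t" for t
    unfolding w_def by (rule integral_nonneg) (auto intro: integrable_continuous_interval \<psi>c \<psi>(2))
  have w\<eta>: "w t \<le> \<eta>" for t
  proof -
    have "integral {0..t} \<psi> \<le> integral UNIV \<psi>"
      by (rule integral_subset_le)
        (auto intro: integrable_continuous_interval \<psi>c \<psi>(2) integrable_on_lborel int)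
    then show ?thesis using int by (simp add: w_def integral_lborel)
  qed
  have wT: "w t = 0" if "t \<le> T" for t
  proof -
    have "integral {0..t} \<psi> = integral {0..t} (\<lambda>_. 0)"
      using that \<psi>(3) by (intro integral_cong) auto
    then show ?thesis by (simp add: w_def)
  qed
  define v where "v t = w t * inverse (f t * f t)" for t
  have vsm: "smooth_on {0<..} v"
    unfolding v_def
    by (rule smooth_on_mult[OF _ wsm smooth_on_compose[OF _ smooth_on_inverse smooth_on_mult[OF _ fsm fsm]]])
      (auto simp: fpos)
  have v0: "0 \<le> v t" for t by (simp add: v_def w0)
  have vT: "v t = 0" if "t \<le> T" for t using that by (simp add: v_def wT)
  \<comment> \<open>As \<open>v\<close> vanishes up to \<open>T\<close>, any lower limit in
    \<open>(0,T]\<close> gives the same \<open>u\<close>. Taking \<open>T/2\<close> keeps the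
    integrand away from \<open>0\<close> and makes \<open>T\<close> an interior point for
    \<open>integral_DERIV\<close>.\<close>
  define u where "u t = 1 + integral {T/2..t} v" for t
  have u1: "u t = 1" if "t \<le> T" for t
  proof -
    have "integral {T/2..t} v = integral {T/2..t} (\<lambda>_. 0)"
      using that by (intro integral_cong vT) auto
    then show ?thesis by (simp add: u_def)
  qed
  have uD: "(u has_real_derivative v t) (at t)" if "0 < t" for t
  proof (cases "t < T")
    case True
    have "((\<lambda>_. 1) has_real_derivative 0) (at t)" by simp
    then have "(u has_real_derivative 0) (at t)"
      by (rule has_field_derivative_transform_within_open[of _ _ _ "{..<T}"]) (use True u1 in auto)
    then show ?thesis using True by (simp add: vT)
  next
    case False
    have "continuous_on {T/2..} v"
      using smooth_on_continuous_on[OF vsm] \<open>T > 0\<close> by (elim continuous_on_subset) auto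
    then have "((\<lambda>t. integral {T/2..t} v) has_real_derivative v t) (at t)"
      using False \<open>T > 0\<close> by (intro integral_DERIV) auto
    then show ?thesis unfolding u_def by (auto intro!: derivative_eq_intros)
  qed
  have usm: "smooth_on {0<..} u"
    by (rule smooth_on_antideriv[OF _ vsm]) (auto intro: uD)
  have ge1: "1 \<le> u t" for t
  proof (cases "t \<le> T")
    case False
    have "u T \<le> u t"
    proof (rule DERIV_nonneg_imp_nondecreasing[where f = u])
      show "\<exists>y. (u has_real_derivative y) (at s) \<and> 0 \<le> y" if "T \<le> s" for s
        using uD[of s] v0[of s] that \<open>T > 0\<close> by auto
    qed (use False in auto)
    then show ?thesis by (simp add: u1)
  qed (simp add: u1)
  have \<eta>0: "0 \<le> \<eta>" using w0 w\<eta> order_trans by blast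
  have le: "u t \<le> 1 + \<eta> * (1 / (a\<^sup>2 * T))" for t
  proof (cases "t \<le> T")
    case True
    then show ?thesis using \<eta>0 \<open>T > 0\<close> by (simp add: u1)
  next
    case False
    \<comment> \<open>\<open>u' = w/f\<^sup>2 \<le> \<eta>/(a s)\<^sup>2\<close>, and the last term is minus the derivative of \<open>\<eta>/(a\<^sup>2 s)\<close>\<close>
    let ?F = "\<lambda>s. u s + \<eta> / a\<^sup>2 * inverse s"
    have "?F t \<le> ?F T"
    proof (rule DERIV_nonpos_imp_nonincreasing[where f = ?F])
      fix s assume s: "T \<le> s"
      then have "0 < s" using \<open>T > 0\<close> by simp
      have "(?F has_real_derivative v s - \<eta> / a\<^sup>2 * inverse (s * s)) (at s)"
        using \<open>0 < s\<close> \<open>a > 0\<close> by (auto intro!: derivative_eq_intros uD simp: power2_eq_square)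
      moreover have "v s \<le> \<eta> / a\<^sup>2 * inverse (s * s)"
      proof -
        have "(a * s) * (a * s) \<le> f s * f s"
          using growth s fpos[OF \<open>0 < s\<close>] \<open>a > 0\<close> \<open>0 < s\<close> by (intro mult_mono) auto
        then have "inverse (f s * f s) \<le> inverse ((a * s) * (a * s))"
          using \<open>a > 0\<close> \<open>0 < s\<close> by (intro le_imp_inverse_le) auto
        then have "v s \<le> \<eta> * inverse ((a * s) * (a * s))"
          unfolding v_def using w\<eta> \<eta>0 by (intro mult_mono) auto
        then show ?thesis by (simp add: power2_eq_square field_simps)
      qed
      ultimately show "\<exists>y. (?F has_real_derivative y) (at s) \<and> y \<le> 0"
        by (intro exI[of _ "v s - \<eta> / a\<^sup>2 * inverse (s * s)"]) auto
    qed (use False in auto)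
    moreover have "0 \<le> \<eta> / a\<^sup>2 * inverse t" using \<eta>0 False \<open>T > 0\<close> by simp
    ultimately show ?thesis by (simp add: u1 divide_inverse)
  qed
  let ?m = "\<lambda>t. f t * u t"
  let ?m' = "\<lambda>t. deriv f t * u t + w t / f t"
  have mD: "deriv ?m t = ?m' t" if "0 < t" for t
  proof -
    have "(?m has_real_derivative deriv f t * u t + v t * f t) (at t)"
      by (rule DERIV_mult[OF fD(1)[OF that] uD[OF that]])
    moreover have "v t * f t = w t / f t" using fpos[OF that] by (simp add: v_def field_simps)
    ultimately show ?thesis by (simp add: DERIV_imp_deriv)
  qed
  have mDD: "deriv (deriv ?m) t = deriv (deriv f) t * u t + \<psi> t / f t" if "0 < t" for t
  proof -
    have "(?m' has_real_derivative
        (deriv (deriv f) t * u t + v t * deriv f t) + (\<psi> t * f t - w t * deriv f t) / (f t * f t)) (at t)"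
      using fpos[OF that]
      by (intro DERIV_add DERIV_mult DERIV_divide fD uD wD that) auto
    \<comment> \<open>Since \<open>v = w / f\<^sup>2\<close>, the two terms containing
      \<open>deriv f\<close> cancel.\<close>
    moreover have "(deriv (deriv f) t * u t + v t * deriv f t) + (\<psi> t * f t - w t * deriv f t) / (f t * f t)
        = deriv (deriv f) t * u t + \<psi> t / f t"
      using fpos[OF that] by (simp add: v_def field_simps)
    ultimately have "(?m' has_real_derivative deriv (deriv f) t * u t + \<psi> t / f t) (at t)" by simp
    then have "(deriv ?m has_real_derivative deriv (deriv f) t * u t + \<psi> t / f t) (at t)"
      by (rule has_field_derivative_transform_within_open[of _ _ _ "{0<..}"]) (use that mD in auto)
    then show ?thesis by (rule DERIV_imp_deriv)
  qed
  obtain g \<delta> where g: "\<delta> > 0" "smooth_on {-\<delta><..<\<delta>} g" "\<forall>x. g (-x) = - g x"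
    "\<forall>t\<in>{0<..<\<delta>}. g t = f t" "deriv g 0 = 1"
    using f unfolding model_fun_def by blast
  \<comment> \<open>On \<open>(0,T)\<close> one has \<open>u = 1\<close>, so the odd extension
    \<open>g\<close> of \<open>f\<close> also serves for the product, on the smaller
    interval.\<close>
  have "model_fun ?m"
    unfolding model_fun_def
  proof (intro conjI exI[of _ g] exI[of _ "min \<delta> T"])
    show "smooth_on {0<..} ?m" by (rule smooth_on_mult[OF _ fsm usm]) simp
    show "\<forall>t>0. ?m t > 0" using fpos less_le_trans[OF zero_less_one ge1] by simp
    show "smooth_on {- min \<delta> T<..<min \<delta> T} g" by (rule smooth_on_subset[OF g(2)]) auto
  qed (use g \<open>T > 0\<close> u1 in auto)
  then show ?thesis using usm ge1 le mDD by (intro exI[of _ u]) simp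
qed

section \<open>Choice of constants and the final estimates\<close>

theorem theorem1p4:
  fixes f :: "real \<Rightarrow> real" and \<epsilon> :: real
  assumes "model_fun f" and "finite_total_curv f" and "total_curv f < 2 * pi"
    and "\<epsilon> > 0"
  shows "\<exists>m. model_fun m \<and> finite_total_curv m \<and>
           (\<forall>t>0. radial_curv m t \<le> radial_curv f t) \<and>
           set_integrable lborel {0<..} (\<lambda>t. \<bar>radial_curv m t - radial_curv f t\<bar>^2) \<and>
           sqrt (\<integral>t\<in>{0<..}. \<bar>radial_curv m t - radial_curv f t\<bar>^2 \<partial>lborel) < \<epsilon> \<and>
           Liminf at_top (\<lambda>t. ereal (radial_curv m t)) = -\<infinity> \<and>
           \<bar>total_curv f - total_curv m\<bar> < \<epsilon>"
proof -
  let ?D = "deriv (deriv f)" and ?K = "radial_curv f"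
  have fpos: "0 < f t" if "0 < t" for t using model_fun_positive[OF assms(1) that] .
  have Dint: "set_integrable lborel {0<..} ?D"
    by (rule finite_total_curv_imp_integrable[OF assms(1,2)])
  obtain a T0 where a: "a > 0" "T0 > 0" and growth: "\<And>t. T0 \<le> t \<Longrightarrow> a * t \<le> f t"
    using model_fun_linear_growth[OF assms(1-3)] by blast
  \<comment> \<open>Beyond \<open>1 / a\<close> the growth bound gives \<open>f t \<ge> 1\<close>,
    so that dividing \<psi> by \<open>f\<close> or \<open>(f t)\<^sup>2 * u t\<close> does not
    enlarge it.\<close>
  define T where "T = max T0 (1 / a)"
  have T: "T > 0" "T \<ge> T0" "T \<ge> 1 / a" using a by (auto simp: T_def)
  have f1: "1 \<le> f t" if "T \<le> t" for t
  proof -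
    have "1 / a \<le> t" using T that by linarith
    then have "1 \<le> a * t" using a by (simp add: field_simps)
    then show ?thesis using growth[of t] that T by linarith
  qed
  define J where "J = (LINT t:{0<..}|lborel. \<bar>?D t\<bar>)"
  define C where "C = 1 / (a\<^sup>2 * T)"
  have J: "J \<ge> 0" unfolding J_def set_lebesgue_integral_def by (intro Bochner_Integration.integral_nonneg) auto
  have C: "C > 0" using a T by (simp add: C_def)
  have CJ: "C * J + 1 > 0" using C J by (simp add: add_nonneg_pos)
  \<comment> \<open>The three bounds give, in order, \<open>u \<le> 2\<close>, the estimate of the
    total curvature (via \<open>2 * pi < 8\<close>), and the estimate of the squared norm. In
    \<open>C * J + 1\<close> the \<open>1\<close> accounts for the integral of \<psi>.\<close>
  define \<eta> where "\<eta> = min (1 / C) (min (\<epsilon> / (8 * (C * J + 1))) (\<epsilon>\<^sup>2 / 2))"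
  have \<eta>: "\<eta> > 0" "\<eta> * C \<le> 1" "8 * (\<eta> * (C * J + 1)) \<le> \<epsilon>" "\<eta> < \<epsilon>\<^sup>2"
  proof -
    show "\<eta> > 0" using C CJ \<open>\<epsilon> > 0\<close> by (simp add: \<eta>_def)
    have "\<eta> \<le> 1 / C" by (simp add: \<eta>_def)
    then show "\<eta> * C \<le> 1" using C by (simp add: field_simps)
    have "\<eta> \<le> \<epsilon> / (8 * (C * J + 1))" by (simp add: \<eta>_def)
    then have "\<eta> * (8 * (C * J + 1)) \<le> \<epsilon>" using CJ by (subst (asm) pos_le_divide_eq) auto
    then show "8 * (\<eta> * (C * J + 1)) \<le> \<epsilon>" by (simp only: mult.left_commute)
    have "\<eta> \<le> \<epsilon>\<^sup>2 / 2" unfolding \<eta>_def by linarith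
    also have "\<dots> < \<epsilon>\<^sup>2" using \<open>\<epsilon> > 0\<close> by simp
    finally show "\<eta> < \<epsilon>\<^sup>2" .
  qed
  \<comment> \<open>\<open>K\<close> need not be bounded above, so the spikes must also outweigh it.\<close>
  define h where "h n = 2 * (f (real n + 1/2))\<^sup>2 * (real n + \<bar>?K (real n + 1/2)\<bar>)" for n
  have h: "0 \<le> h n" for n by (simp add: h_def)
  obtain \<psi> :: "real \<Rightarrow> real" where \<psi>: "smooth_on UNIV \<psi>" "\<And>t. 0 \<le> \<psi> t"
    "\<And>t. t \<le> T \<Longrightarrow> \<psi> t = 0" "\<And>n. T \<le> real n \<Longrightarrow> \<psi> (real n + 1/2) = h n"
    "integrable lborel \<psi>" "(\<integral>t. \<psi> t \<partial>lborel) \<le> \<eta>"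
    "integrable lborel (\<lambda>t. (\<psi> t)\<^sup>2)" "(\<integral>t. (\<psi> t)\<^sup>2 \<partial>lborel) \<le> \<eta>"
    by (rule smooth_spikes_exist[of h, OF h less_imp_le[OF T(1)] \<eta>(1)]) (rule that; simp)
  have growth': "\<forall>t\<ge>T. a * t \<le> f t" and \<psi>T: "\<forall>t\<le>T. \<psi> t = 0"
    using growth \<psi>(3) T by auto
  obtain u where u: "smooth_on {0<..} u" "\<forall>t>0. 1 \<le> u t" "\<forall>t>0. u t \<le> 1 + \<eta> * C"
    and model: "model_fun (\<lambda>t. f t * u t)"
    and mDD: "\<forall>t>0. deriv (deriv (\<lambda>t. f t * u t)) t = ?D t * u t + \<psi> t / f t"
    using model_fun_perturbation[OF assms(1) a(1) T(1) growth' \<psi>(1,2) \<psi>T \<psi>(5,6), folded C_def]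
    by (elim exE conjE) (rule that)
  note u = u(1) u(2,3)[rule_format]
  define m where "m t = f t * u t" for t
  have model: "model_fun m" using model unfolding m_def .
  have mDD: "deriv (deriv m) t = ?D t * u t + \<psi> t / f t" if "0 < t" for t
    using mDD that unfolding m_def by simp
  define \<phi> where "\<phi> t = \<psi> t / ((f t)\<^sup>2 * u t)" for t
  have G: "radial_curv m t = ?K t - \<phi> t" if "0 < t" for t
    using fpos[OF that] u(2)[OF that] mDD[OF that]
    by (simp add: radial_curv_def m_def \<phi>_def field_simps power2_eq_square)
  have \<phi>0: "0 \<le> \<phi> t" if "0 < t" for t using \<psi>(2)[of t] u(2)[OF that] by (simp add: \<phi>_def)
  \<comment> \<open>A lower bound on the divisor matters only beyond \<open>T\<close>, because
    \<psi> vanishes before.\<close>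
  have quot: "\<psi> t / x \<le> \<psi> t" if "0 < t" "T \<le> t \<Longrightarrow> 1 \<le> x" for t x
  proof (cases "T \<le> t")
    case True
    then show ?thesis using \<psi>(2)[of t] that by (simp add: divide_le_eq mult_le_cancel_left1)
  qed (simp add: \<psi>(3))
  have \<phi>\<psi>: "\<phi> t \<le> \<psi> t" if "0 < t" for t
    unfolding \<phi>_def
  proof (rule quot[OF that])
    assume "T \<le> t"
    then have "1 * 1 \<le> (f t)\<^sup>2 * u t"
      using f1[of t] u(2)[OF that] by (intro mult_mono) auto
    then show "1 \<le> (f t)\<^sup>2 * u t" by simp
  qed
  have cont: "continuous_on {0<..} \<psi>" "continuous_on {0<..} f" "continuous_on {0<..} u"
    using \<psi>(1) u(1) model_fun_smooth_on[OF assms(1)] smooth_on_subset[OF \<psi>(1)]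
    by (auto intro: smooth_on_continuous_on)
  have sq_int: "set_integrable lborel {0<..} (\<lambda>t. (\<psi> t)\<^sup>2)"
    and sq_le: "(LINT t:{0<..}|lborel. (\<psi> t)\<^sup>2) \<le> \<eta>"
    using set_integral_le_integral[OF \<psi>(7), of "{0<..}"] \<psi>(8) by auto
  have \<phi>_int: "set_integrable lborel {0<..} (\<lambda>t. (\<phi> t)\<^sup>2)"
  proof (rule set_integrable_bound[OF sq_int])
    have "continuous_on {0<..} (\<lambda>t. (\<phi> t)\<^sup>2)"
      unfolding \<phi>_def using fpos u(2)
      by (intro continuous_intros cont) force
    then show "set_borel_measurable lborel {0<..} (\<lambda>t. (\<phi> t)\<^sup>2)"
      unfolding set_borel_measurable_def by (simp add: borel_measurable_continuous_on_indicator del: real_scaleR_def)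
    show "AE t in lborel. t \<in> {0<..} \<longrightarrow> norm ((\<phi> t)\<^sup>2) \<le> norm ((\<psi> t)\<^sup>2)"
      using \<phi>0 \<phi>\<psi> by (auto intro: power_mono)
  qed
  have diff: "\<bar>radial_curv m t - ?K t\<bar>^2 = (\<phi> t)\<^sup>2" if "0 < t" for t
    using G[OF that] by simp
  have L2: "(LINT t:{0<..}|lborel. \<bar>radial_curv m t - ?K t\<bar>^2) < \<epsilon>\<^sup>2"
  proof -
    have "(LINT t:{0<..}|lborel. \<bar>radial_curv m t - ?K t\<bar>^2) = (LINT t:{0<..}|lborel. (\<phi> t)\<^sup>2)"
      using diff by (intro set_lebesgue_integral_cong) auto
    also have "\<dots> \<le> (LINT t:{0<..}|lborel. (\<psi> t)\<^sup>2)"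
      using \<phi>0 \<phi>\<psi> by (intro set_integral_mono \<phi>_int sq_int) (auto intro: power_mono)
    also have "\<dots> < \<epsilon>\<^sup>2" using sq_le \<eta>(4) by simp
    finally show ?thesis .
  qed
  have \<psi>_int: "set_integrable lborel {0<..} \<psi>" and \<psi>_le: "(LINT t:{0<..}|lborel. \<psi> t) \<le> \<eta>"
    using set_integral_le_integral[OF \<psi>(5) \<psi>(2), of "{0<..}"] \<psi>(6) by auto
  \<comment> \<open>This function dominates \<open>m'' - f'' = (u - 1) f'' + \<psi>/f\<close>. It
    yields both the integrability of \<open>m''\<close> and the bound on the change of total
    curvature.\<close>
  have bound_int: "set_integrable lborel {0<..} (\<lambda>t. \<eta> * C * \<bar>?D t\<bar> + \<psi> t)"
    by (intro set_integral_add set_integrable_mult_right set_integrable_abs Dint \<psi>_int)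
  have close: "\<bar>deriv (deriv m) t - ?D t\<bar> \<le> \<eta> * C * \<bar>?D t\<bar> + \<psi> t" if "0 < t" for t
  proof -
    have "deriv (deriv m) t - ?D t = (u t - 1) * ?D t + \<psi> t / f t"
      using mDD[OF that] by (simp add: algebra_simps)
    also have "\<bar>\<dots>\<bar> \<le> \<bar>(u t - 1) * ?D t\<bar> + \<bar>\<psi> t / f t\<bar>" by (rule abs_triangle_ineq)
    also have "\<bar>(u t - 1) * ?D t\<bar> \<le> \<eta> * C * \<bar>?D t\<bar>"
      unfolding abs_mult using u(2,3)[OF that] by (intro mult_right_mono) auto
    also have "\<bar>\<psi> t / f t\<bar> \<le> \<psi> t"
      using quot[OF that f1] \<psi>(2)[of t] fpos[OF that] by simp
    finally show ?thesis by simp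
  qed
  have diff_int: "set_integrable lborel {0<..} (\<lambda>t. deriv (deriv m) t - ?D t)"
  proof (rule set_integrable_bound[OF bound_int])
    have "continuous_on {0<..} (\<lambda>t. deriv (deriv m) t - ?D t)"
      by (intro continuous_on_diff smooth_on_continuous_on smooth_on_deriv model_fun_smooth_on model assms)
    then show "set_borel_measurable lborel {0<..} (\<lambda>t. deriv (deriv m) t - ?D t)"
      unfolding set_borel_measurable_def by (simp add: borel_measurable_continuous_on_indicator del: real_scaleR_def)
    show "AE t in lborel. t \<in> {0<..} \<longrightarrow> norm (deriv (deriv m) t - ?D t) \<le> norm (\<eta> * C * \<bar>?D t\<bar> + \<psi> t)"
      using close by (intro AE_I2) (force intro: order_trans[OF _ abs_ge_self])
  qed
  have mint: "set_integrable lborel {0<..} (deriv (deriv m))"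
    using set_integral_add(1)[OF diff_int Dint] by simp
  have tc: "\<bar>total_curv f - total_curv m\<bar> < \<epsilon>"
  proof -
    have "\<bar>LINT t:{0<..}|lborel. deriv (deriv m) t - ?D t\<bar> \<le> (LINT t:{0<..}|lborel. \<bar>deriv (deriv m) t - ?D t\<bar>)"
      using set_integral_norm_bound[OF diff_int] by simp
    also have "\<dots> \<le> (LINT t:{0<..}|lborel. \<eta> * C * \<bar>?D t\<bar> + \<psi> t)"
      using close by (intro set_integral_mono set_integrable_abs diff_int bound_int) auto
    also have "\<dots> = \<eta> * C * J + (LINT t:{0<..}|lborel. \<psi> t)"
      unfolding J_def using Dint \<psi>_int
      by (subst set_integral_add(2)) (auto intro: set_integrable_abs)
    also have "\<dots> \<le> \<eta> * (C * J + 1)" using \<psi>_le by (simp add: algebra_simps)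
    finally have le: "\<bar>LINT t:{0<..}|lborel. deriv (deriv m) t - ?D t\<bar> \<le> \<eta> * (C * J + 1)" .
    have "total_curv f - total_curv m = 2 * pi * (LINT t:{0<..}|lborel. deriv (deriv m) t - ?D t)"
      using total_curv_eq_integral(2)[OF model mint] total_curv_eq_integral(2)[OF assms(1) Dint]
        set_integral_diff(2)[OF mint Dint] by (simp add: right_diff_distrib)
    then have "\<bar>total_curv f - total_curv m\<bar> = 2 * pi * \<bar>LINT t:{0<..}|lborel. deriv (deriv m) t - ?D t\<bar>"
      by (simp add: abs_mult)
    also have "\<dots> \<le> 2 * pi * (\<eta> * (C * J + 1))" using le by (intro mult_left_mono) auto
    also have "\<dots> < 8 * (\<eta> * (C * J + 1))"
      using pi_less_4 \<eta>(1) CJ by (intro mult_strict_right_mono) auto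
    also have "\<dots> \<le> \<epsilon>" by (rule \<eta>(3))
    finally show ?thesis .
  qed
  have Lim: "Liminf at_top (\<lambda>t. ereal (radial_curv m t)) = -\<infinity>"
  proof (rule Liminf_at_top_eq_MInf)
    fix B M :: real
    \<comment> \<open>The bound by \<open>T\<close> ensures that spike \<open>n\<close> is present.
      The bound by \<open>- M\<close> suffices because the drop at its centre is at least
      \<open>n + \<bar>K\<bar>\<close>, leaving curvature at most \<open>-n\<close>.\<close>
    obtain n :: nat where n: "max (max B T) (- M) \<le> real n" using real_arch_simple by blast
    define p where "p = real n + 1/2"
    have p: "0 < p" "B \<le> p" using n by (auto simp: p_def)
    have "\<psi> p = 2 * (f p)\<^sup>2 * (real n + \<bar>?K p\<bar>)" using \<psi>(4)[of n] n by (simp add: p_def h_def)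
    then have "\<phi> p = 2 / u p * (real n + \<bar>?K p\<bar>)"
      using fpos[OF p(1)] by (simp add: \<phi>_def)
    \<comment> \<open>The factor 2 in \<open>h\<close> pays for
      \<open>u p \<le> 1 + \<eta> * C \<le> 2\<close>.\<close>
    moreover have "1 \<le> 2 / u p"
      using u(2,3)[OF p(1)] \<eta>(2) by (simp add: le_divide_eq)
    then have "1 * (real n + \<bar>?K p\<bar>) \<le> 2 / u p * (real n + \<bar>?K p\<bar>)"
      by (intro mult_right_mono) auto
    ultimately have "real n + \<bar>?K p\<bar> \<le> \<phi> p" by simp
    then have "radial_curv m p \<le> M" using G[OF p(1)] n by auto
    then show "\<exists>t\<ge>B. radial_curv m t \<le> M" using p(2) by blast
  qed
  have int2: "set_integrable lborel {0<..} (\<lambda>t. \<bar>radial_curv m t - ?K t\<bar>^2)"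
    using \<phi>_int diff by (subst set_integrable_cong[OF refl refl, of _ _ "\<lambda>t. (\<phi> t)\<^sup>2"]) auto
  have "sqrt (LINT t:{0<..}|lborel. \<bar>radial_curv m t - ?K t\<bar>^2) < \<epsilon>"
    using real_sqrt_less_mono[OF L2] \<open>\<epsilon> > 0\<close> by simp
  then show ?thesis
    using model total_curv_eq_integral(1)[OF model mint] G \<phi>0 int2 Lim tc
    by (intro exI[of _ m]) auto
qed

end
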